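(* For $Z\in\mathbb{C}^{n\times k}$ let $\mathcal{F}(Z)$ denote the set of $(x,V,\Lambda)\in\mathbb{R}^{2n}\times\mathbb{C}^{n\times k}\times\mathbb{R}^{m\times\ell}$ satisfying $$H_i(V,Z)-C_i+(b_i^Tx)e_1e_1^T-\sum_{j=1}^{\ell}[\Lambda]_{ij}W_j\preceq 0\ \ (i=1,\dots,m),\qquad Ex\le f,\qquad \Lambda\le 0 .$$ Let $v_0\in\mathbb{C}^n$ be a feasible solution of the zero-recourse AC-OPF problem $$\begin{aligned}\text{minimize}\quad & \sum_{i=1}^n\alpha_i\,v^H\left(\frac{S_i+S_i^H}{2}\right)v\\ \text{subject to}\quad & v\in\mathbb{C}^n,\\ & \gamma_i^{\min}-d_i\le v^HS_iv\le\gamma_i^{\max}-d_i,\quad i\in\mathcal{V},\\ & v_i^{\min}\le|v_i|\le v_i^{\max},\quad i\in\mathcal{V},\\ & -\ell_{ij}^{\max}\le v^HP_{ij}v\le\ell_{ij}^{\max},\quad (i,j)\in\mathcal{E},\end{aligned}$$ where $$\gamma_i^{\min}=\max_{\xi\in\Xi}\mathrm{Re}\{\underline{g}_i(\xi)\}+\mathbf{j}\max_{\xi\in\Xi}\mathrm{Im}\{\underline{g}_i(\xi)\},\qquad \gamma_i^{\max}=\min_{\xi\in\Xi}\mathrm{Re}\{\overline{g}_i(\xi)\}+\mathbf{j}\min_{\xi\in\Xi}\mathrm{Im}\{\overline{g}_i(\xi)\},$$ and define $V_0=v_0e_1^T\in\mathbb{C}^{n\times k}$. Let $\{(x_t,V_t,\Lambda_t)\}_{t=1}^\infty$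 be a sequence of solutions generated by the recursion $$(x_{t+1},V_{t+1},\Lambda_{t+1})\in\underset{(x,V,\Lambda)\in\mathcal{F}(V_t)}{\mathrm{argmin}}\ \mathrm{Tr}(MH_0(V,V_t)),\qquad t=0,1,2,\dots$$ Then at each step of the recursion: (i) (Nonemptiness) $\mathcal{F}(V_t)\neq\emptyset$ for every $t\ge 0$; (ii) (Cost monotonicity) $\mathrm{Tr}(MV_t^HA_0V_t)\le\mathrm{Tr}(MV_{t-1}^HA_0V_{t-1})$ for every $t\ge1$.
   Context: Notation. $e_i$ is the $i$-th standard basis vector (dimension clear from context); $X^H$ is conjugate transpose; $\mathbf{j}$ is the imaginary unit; $X\preceq 0$ ($X\succeq 0$) means Hermitian negative (positive) semidefinite; inequalities between real vectors or matrices (e.g. $\Lambda\le 0$, $Ex\le f$) are entrywise; for complex numbers, $z_1\le z_2$ means $\mathrm{Re}\,z_1\le\mathrm{Re}\,z_2$ and $\mathrm{Im}\,z_1\le \mathrm{Im}\,z_2$; $\mathrm{Re}$ and $\mathrm{Im}$ of vectors are entrywise. Uncertainty. $\boldsymbol{\xi}$ is a random vector in $\mathbb{R}^k$ with second-moment matrix $M=\mathbb{E}[\boldsymbol{\xi}\boldsymbol{\xi}^T]$, whose support is the nonempty compact set $\Xi=\{\xi\in\mathbb{R}^k: \xi_1=1,\ \xi^TW_j\xi\ge 0,\ j=1,\dots,\ell\}$, where $W_j=\begin{bmatrix}\omega_j & w_j^T\\ w_j & -\Omega_j^T\Omega_j\end{bmatrix}\in\mathbb{R}^{k\times k}$, $\omega_j\in\mathbb{R}$,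 $w_j\in\mathbb{R}^{k-1}$, $\Omega_j\in\mathbb{R}^{n_j\times(k-1)}$. It is assumed that some $\xi\in\Xi$ satisfies $\xi^TW_j\xi>0$ for all $j$ (which implies that $M$ is positive definite). Network. $\mathcal{V}=\{1,\dots,n\}$ is the set of buses and $\mathcal{E}\subseteq\mathcal{V}\times\mathcal{V}$ the set of lines, with $(i,j)\in\mathcal{E}$ iff $(j,i)\in\mathcal{E}$. $Y\in\mathbb{C}^{n\times n}$ is the bus admittance matrix, $\widehat{y}_{ij}\in\mathbb{C}$ the shunt admittance of line $(i,j)$. Set $S_i=Y^He_ie_i^T$, $\Phi_i=(S_i+S_i^H)/2$, $\Psi_i=(S_i-S_i^H)/(2\mathbf{j})$ for $i\in\mathcal{V}$, and for $(i,j)\in\mathcal{E}$, $S_{ij}=e_ie_i^T(\widehat{y}_{ij}/2-[Y]_{ij})^H+e_je_i^T[Y]_{ij}^H$, $P_{ij}=(S_{ij}+S_{ij}^H)/2$. Parameters. For each bus $i$: marginal cost $\alpha_i\ge 0$, demand $d_i\in\mathbb{C}$, capacities $g_i^{\min},g_i^{\max}\in\mathbb{C}$ (stacked into vectors $g^{\min},g^{\max}$), ramp-down and ramp-up limits $r_i^{\min},r_i^{\max}\in\mathbb{C}$ with $r_i^{\min}\le 0\le r_i^{\max}$, voltage magnitude limits $v_i^{\min},v_i^{\max}\in\mathbb{R}$ with $v_i^{\min}\ge 0$; for each line, flow capacity $\ell_{ij}^{\max}\in\mathbb{R}$. Real-time capacity bounds are $\underline{g}(\xi)=\underline{G}\xi$,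 $\overline{g}(\xi)=\overline{G}\xi$ with $\underline{G},\overline{G}\in\mathbb{C}^{n\times k}$, and $g_i^{\min}\le\underline{g}_i(\xi)\le\overline{g}_i(\xi)\le g_i^{\max}$ for all $\xi\in\Xi$, $i\in\mathcal{V}$. Problem data. $A_0=\sum_{i=1}^n\alpha_i\Phi_i$. With $m=10n+2|\mathcal{E}|$, the triples $(A_i,b_i,c_i)$, $i=1,\dots,m$, with $A_i\in\mathbb{C}^{n\times n}$ Hermitian, $b_i\in\mathbb{R}^{2n}$, $c_i\in\mathbb{R}^k$, enumerate the following: for every $i\in\mathcal{V}$, the ten triples $(\Phi_i,\,0,\,\mathrm{Re}\{\overline{G}^Te_i-d_ie_1\})$, $(-\Phi_i,\,0,\,\mathrm{Re}\{d_ie_1-\underline{G}^Te_i\})$, $(\Psi_i,\,0,\,\mathrm{Im}\{\overline{G}^Te_i-d_ie_1\})$, $(-\Psi_i,\,0,\,\mathrm{Im}\{d_ie_1-\underline{G}^Te_i\})$, $(\Phi_i,\,-e_i,\,\mathrm{Re}\{r_i^{\max}-d_i\}e_1)$, $(-\Phi_i,\,e_i,\,\mathrm{Re}\{d_i-r_i^{\min}\}e_1)$, $(\Psi_i,\,-e_{n+i},\,\mathrm{Im}\{r_i^{\max}-d_i\}e_1)$, $(-\Psi_i,\,e_{n+i},\,\mathrm{Im}\{d_i-r_i^{\min}\}e_1)$, $(e_ie_i^T,\,0,\,(v_i^{\max})^2e_1)$, $(-e_ie_i^T,\,0,\,-(v_i^{\min})^2e_1)$; and for every $(i,j)\in\mathcal{E}$,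 the two triples $(P_{ij},\,0,\,\ell_{ij}^{\max}e_1)$, $(-P_{ij},\,0,\,\ell_{ij}^{\max}e_1)$. Also $E=\begin{bmatrix}I_{2n}&-I_{2n}\end{bmatrix}^T\in\mathbb{R}^{4n\times 2n}$, $f=[\mathrm{Re}\{g^{\max}\}^T,\ \mathrm{Im}\{g^{\max}\}^T,\ -\mathrm{Re}\{g^{\min}\}^T,\ -\mathrm{Im}\{g^{\min}\}^T]^T\in\mathbb{R}^{4n}$, and $C_i=(e_1c_i^T+c_ie_1^T)/2$. Majorizers. For $i=0,1,\dots,m$, write $A_i=A_i^++A_i^-$ with $A_i^+\succeq0$ and $A_i^-\preceq0$ the positive and negative semidefinite parts of $A_i$, and for $V,Z\in\mathbb{C}^{n\times k}$ let $H_i(V,Z)=V^HA_i^+V+Z^HA_i^-V+V^HA_i^-Z-Z^HA_i^-Z$. *)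

theory Defs
  imports "HOL-Probability.Probability" "HOL-Library.Extended_Nat"
begin

definition cadj :: "complex^'c^'r \<Rightarrow> complex^'r^'c" where
  "cadj X = (\<chi> i j. cnj (X $ j $ i))"

definition outer :: "('a::times)^'r \<Rightarrow> 'a^'c \<Rightarrow> 'a^'c^'r" where
  "outer u v = (\<chi> i j. u $ i * v $ j)"

definition cscale :: "complex \<Rightarrow> complex^'c^'r \<Rightarrow> complex^'c^'r" where
  "cscale z X = (\<chi> i j. z * X $ i $ j)"

abbreviation cmat :: "real^'c^'r \<Rightarrow> complex^'c^'r" where
  "cmat X \<equiv> map_matrix complex_of_real X"

definition cvec :: "real^'k \<Rightarrow> complex^'k" where
  "cvec v = (\<chi> a. complex_of_real (v $ a))"

definition Re_vec :: "complex^'k \<Rightarrow> real^'k" where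
  "Re_vec v = (\<chi> a. Re (v $ a))"

definition Im_vec :: "complex^'k \<Rightarrow> real^'k" where
  "Im_vec v = (\<chi> a. Im (v $ a))"

text \<open>The form \<open>v\<^sup>H X v\<close>.\<close>

definition qform :: "complex^'n^'n \<Rightarrow> complex^'n \<Rightarrow> complex" where
  "qform X v = (\<Sum>i\<in>UNIV. \<Sum>j\<in>UNIV. cnj (v $ i) * X $ i $ j * v $ j)"

definition hermitian :: "complex^'n^'n \<Rightarrow> bool" where
  "hermitian X \<longleftrightarrow> cadj X = X"

definition psd :: "complex^'n^'n \<Rightarrow> bool" where
  "psd X \<longleftrightarrow> hermitian X \<and> (\<forall>v. 0 \<le> Re (qform X v))"

definition nsd :: "complex^'n^'n \<Rightarrow> bool" where
  "nsd X \<longleftrightarrow> hermitian X \<and> (\<forall>v. Re (qform X v) \<le> 0)"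

text \<open>\<open>P\<close> and \<open>N\<close> are the positive and negative semidefinite parts of the Hermitian matrix \<open>A\<close>.
  Without \<open>P ** N = 0\<close> the splitting would not be unique; with it, \<open>P\<close> and \<open>N\<close> are obtained
  from \<open>A\<close> by keeping the nonnegative, respectively nonpositive, eigenvalues.\<close>

definition semidef_parts :: "complex^'n^'n \<Rightarrow> complex^'n^'n \<Rightarrow> complex^'n^'n \<Rightarrow> bool" where
  "semidef_parts A P N \<longleftrightarrow> A = P + N \<and> psd P \<and> nsd N \<and> P ** N = 0"

text \<open>Entrywise comparison of real and of imaginary parts; this is not the order of
  \<open>HOL-Library.Complex_Order\<close>, which requires equal imaginary parts.\<close>

definition cle :: "complex \<Rightarrow> complex \<Rightarrow> bool" (infix "\<le>\<^sub>c" 50) where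
  "z1 \<le>\<^sub>c z2 \<longleftrightarrow> Re z1 \<le> Re z2 \<and> Im z1 \<le> Im z2"

text \<open>\<open>\<real>\<^sup>k\<close> is \<open>real^'k\<close> with a distinguished index \<open>fst_idx\<close> playing the role of the coordinate 1,
  so that \<open>\<real>\<^sup>k\<^sup>-\<^sup>1\<close> corresponds to the indices different from \<open>fst_idx\<close>: only these arguments of
  \<open>w_cf\<close> and \<open>Om_cf\<close> are ever used. \<open>Om_cf D j r a\<close> is the entry of \<open>\<Omega>\<^sub>j\<close> in row \<open>r < Om_rows D j\<close>
  and column \<open>a\<close>. The values of \<open>flow_cap\<close> and \<open>shunt\<close> matter only on \<open>edges\<close>.\<close>

record ('n, 'k, 'l) acopf =
  fst_idx :: 'k
  om_cf :: "'l \<Rightarrow> real"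
  w_cf :: "'l \<Rightarrow> 'k \<Rightarrow> real"
  Om_rows :: "'l \<Rightarrow> nat"
  Om_cf :: "'l \<Rightarrow> nat \<Rightarrow> 'k \<Rightarrow> real"
  edges :: "('n \<times> 'n) set"
  adm :: "complex^'n::finite^'n::finite"
  shunt :: "'n \<Rightarrow> 'n \<Rightarrow> complex"
  mcost :: "real^'n"
  demand :: "complex^'n"
  g_min :: "complex^'n"
  g_max :: "complex^'n"
  r_min :: "complex^'n"
  r_max :: "complex^'n"
  v_min :: "real^'n"
  v_max :: "real^'n"
  flow_cap :: "'n \<Rightarrow> 'n \<Rightarrow> real"
  G_lo :: "complex^'k::finite^'n"
  G_up :: "complex^'k^'n"

definition e1 :: "('n::finite, 'k::finite, 'l) acopf \<Rightarrow> ('a::zero_neq_one)^'k" where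
  "e1 D = axis (fst_idx D) 1"

definition W_mat :: "('n::finite, 'k::finite, 'l) acopf \<Rightarrow> 'l \<Rightarrow> real^'k^'k" where
  "W_mat D j = (\<chi> a b.
     if a = fst_idx D \<and> b = fst_idx D then om_cf D j
     else if a = fst_idx D then w_cf D j b
     else if b = fst_idx D then w_cf D j a
     else - (\<Sum>r<Om_rows D j. Om_cf D j r a * Om_cf D j r b))"

definition Xi :: "('n::finite, 'k::finite, 'l) acopf \<Rightarrow> (real^'k) set" where
  "Xi D = {\<xi>. \<xi> $ fst_idx D = 1 \<and> (\<forall>j. \<xi> \<bullet> (W_mat D j *v \<xi>) \<ge> 0)}"

definition rv_support :: "'w measure \<Rightarrow> ('w \<Rightarrow> 'a::topological_space) \<Rightarrow> 'a set" where
  "rv_support P X = {x. \<forall>U. open U \<and> x \<in> U \<longrightarrow> measure P (X -` U \<inter> space P) > 0}"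

definition second_moment :: "'w measure \<Rightarrow> ('w \<Rightarrow> real^'k) \<Rightarrow> real^'k^'k" where
  "second_moment P X = (\<chi> a b. \<integral>\<omega>. X \<omega> $ a * X \<omega> $ b \<partial>P)"

definition g_lo :: "('n::finite, 'k::finite, 'l) acopf \<Rightarrow> real^'k \<Rightarrow> complex^'n" where
  "g_lo D \<xi> = G_lo D *v cvec \<xi>"

definition g_up :: "('n::finite, 'k::finite, 'l) acopf \<Rightarrow> real^'k \<Rightarrow> complex^'n" where
  "g_up D \<xi> = G_up D *v cvec \<xi>"

definition S_bus :: "('n::finite, 'k::finite, 'l) acopf \<Rightarrow> 'n \<Rightarrow> complex^'n^'n" where
  "S_bus D i = cadj (adm D) ** outer (axis i 1) (axis i 1)"

definition Phi :: "('n::finite, 'k::finite, 'l) acopf \<Rightarrow> 'n \<Rightarrow> complex^'n^'n" where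
  "Phi D i = cscale (1/2) (S_bus D i + cadj (S_bus D i))"

definition Psi :: "('n::finite, 'k::finite, 'l) acopf \<Rightarrow> 'n \<Rightarrow> complex^'n^'n" where
  "Psi D i = cscale (1/(2*\<i>)) (S_bus D i - cadj (S_bus D i))"

definition S_line :: "('n::finite, 'k::finite, 'l) acopf \<Rightarrow> 'n \<Rightarrow> 'n \<Rightarrow> complex^'n^'n" where
  "S_line D i j =
     cscale (cnj (shunt D i j / 2 - adm D $ i $ j)) (outer (axis i 1) (axis i 1))
     + cscale (cnj (adm D $ i $ j)) (outer (axis j 1) (axis i 1))"

definition P_line :: "('n::finite, 'k::finite, 'l) acopf \<Rightarrow> 'n \<Rightarrow> 'n \<Rightarrow> complex^'n^'n" where
  "P_line D i j = cscale (1/2) (S_line D i j + cadj (S_line D i j))"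

definition A0_mat :: "('n::finite, 'k::finite, 'l) acopf \<Rightarrow> complex^'n^'n" where
  "A0_mat D = (\<Sum>i\<in>UNIV. cscale (complex_of_real (mcost D $ i)) (Phi D i))"

datatype 'n con =
    PCapUp 'n | PCapLo 'n | QCapUp 'n | QCapLo 'n
  | PRampUp 'n | PRampLo 'n | QRampUp 'n | QRampLo 'n
  | VoltUp 'n | VoltLo 'n
  | FlowUp 'n 'n | FlowLo 'n 'n

definition con_set :: "('n \<times> 'n) set \<Rightarrow> 'n con set" where
  "con_set E =
     range PCapUp \<union> range PCapLo \<union> range QCapUp \<union> range QCapLo
     \<union> range PRampUp \<union> range PRampLo \<union> range QRampUp \<union> range QRampLo
     \<union> range VoltUp \<union> range VoltLo
     \<union> (\<lambda>(i, j). FlowUp i j) ` E \<union> (\<lambda>(i, j). FlowLo i j) ` E"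

text \<open>\<open>\<real>\<^sup>2\<^sup>n\<close> is indexed by \<open>'n + 'n\<close>, so \<open>e\<^sub>i\<close> and \<open>e\<^sub>n\<^sub>+\<^sub>i\<close> are \<open>axis (Inl i) 1\<close> and \<open>axis (Inr i) 1\<close>.\<close>

fun con_data :: "('n::finite, 'k::finite, 'l) acopf \<Rightarrow> 'n con
    \<Rightarrow> (complex^'n^'n) \<times> (real^('n + 'n)) \<times> (real^'k)" where
  "con_data D (PCapUp i) =
     (Phi D i, 0, Re_vec (transpose (G_up D) *v axis i 1 - demand D $ i *s e1 D))"
| "con_data D (PCapLo i) =
     (- Phi D i, 0, Re_vec (demand D $ i *s e1 D - transpose (G_lo D) *v axis i 1))"
| "con_data D (QCapUp i) =
     (Psi D i, 0, Im_vec (transpose (G_up D) *v axis i 1 - demand D $ i *s e1 D))"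
| "con_data D (QCapLo i) =
     (- Psi D i, 0, Im_vec (demand D $ i *s e1 D - transpose (G_lo D) *v axis i 1))"
| "con_data D (PRampUp i) =
     (Phi D i, - axis (Inl i) 1, Re (r_max D $ i - demand D $ i) *s e1 D)"
| "con_data D (PRampLo i) =
     (- Phi D i, axis (Inl i) 1, Re (demand D $ i - r_min D $ i) *s e1 D)"
| "con_data D (QRampUp i) =
     (Psi D i, - axis (Inr i) 1, Im (r_max D $ i - demand D $ i) *s e1 D)"
| "con_data D (QRampLo i) =
     (- Psi D i, axis (Inr i) 1, Im (demand D $ i - r_min D $ i) *s e1 D)"
| "con_data D (VoltUp i) =
     (outer (axis i 1) (axis i 1), 0, (v_max D $ i)\<^sup>2 *s e1 D)"
| "con_data D (VoltLo i) =
     (- outer (axis i 1) (axis i 1), 0, (- ((v_min D $ i)\<^sup>2)) *s e1 D)"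
| "con_data D (FlowUp i j) = (P_line D i j, 0, flow_cap D i j *s e1 D)"
| "con_data D (FlowLo i j) = (- P_line D i j, 0, flow_cap D i j *s e1 D)"

text \<open>An enumeration of the triples is a bijection \<open>\<sigma>\<close> from a finite index type \<open>'m\<close> onto
  \<open>con_set (edges D)\<close>; then \<open>CARD('m) = 10 * n + 2 * card (edges D)\<close>. The index 0 of the
  cost matrix is \<open>None\<close>.\<close>

fun A_mat :: "('n::finite, 'k::finite, 'l) acopf \<Rightarrow> ('m \<Rightarrow> 'n con) \<Rightarrow> 'm option \<Rightarrow> complex^'n^'n" where
  "A_mat D \<sigma> None = A0_mat D"
| "A_mat D \<sigma> (Some i) = fst (con_data D (\<sigma> i))"

definition b_vec :: "('n::finite, 'k::finite, 'l) acopf \<Rightarrow> ('m \<Rightarrow> 'n con) \<Rightarrow> 'm \<Rightarrow> real^('n + 'n)" where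
  "b_vec D \<sigma> i = fst (snd (con_data D (\<sigma> i)))"

definition c_vec :: "('n::finite, 'k::finite, 'l) acopf \<Rightarrow> ('m \<Rightarrow> 'n con) \<Rightarrow> 'm \<Rightarrow> real^'k" where
  "c_vec D \<sigma> i = snd (snd (con_data D (\<sigma> i)))"

definition C_mat :: "('n::finite, 'k::finite, 'l) acopf \<Rightarrow> ('m \<Rightarrow> 'n con) \<Rightarrow> 'm \<Rightarrow> real^'k^'k" where
  "C_mat D \<sigma> i = (1/2) *\<^sub>R (outer (e1 D) (c_vec D \<sigma> i) + outer (c_vec D \<sigma> i) (e1 D))"

definition E_mat :: "real^('n::finite + 'n)^(('n + 'n) + ('n + 'n))" where
  "E_mat = (\<chi> r c. case r of Inl a \<Rightarrow> mat 1 $ a $ c | Inr a \<Rightarrow> - (mat 1 $ a $ c))"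

definition f_vec :: "('n::finite, 'k::finite, 'l) acopf \<Rightarrow> real^(('n + 'n) + ('n + 'n))" where
  "f_vec D = (\<chi> r. case r of
       Inl (Inl i) \<Rightarrow> Re (g_max D $ i)
     | Inl (Inr i) \<Rightarrow> Im (g_max D $ i)
     | Inr (Inl i) \<Rightarrow> - Re (g_min D $ i)
     | Inr (Inr i) \<Rightarrow> - Im (g_min D $ i))"

definition majorizer :: "complex^'n^'n \<Rightarrow> complex^'n^'n \<Rightarrow> complex^'k^'n \<Rightarrow> complex^'k^'n \<Rightarrow> complex^'k^'k" where
  "majorizer P N V Z = cadj V ** P ** V + cadj Z ** N ** V + cadj V ** N ** Z - cadj Z ** N ** Z"

definition F_set :: "('n::finite, 'k::finite, 'l::finite) acopf \<Rightarrow> ('m::finite \<Rightarrow> 'n con)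
    \<Rightarrow> ('m option \<Rightarrow> complex^'n^'n) \<Rightarrow> ('m option \<Rightarrow> complex^'n^'n) \<Rightarrow> complex^'k^'n
    \<Rightarrow> ((real^('n + 'n)) \<times> (complex^'k^'n) \<times> (real^'l^'m)) set" where
  "F_set D \<sigma> Ap An Z = {(x, V, \<Lambda>).
     (\<forall>i. nsd (majorizer (Ap (Some i)) (An (Some i)) V Z
               - cmat (C_mat D \<sigma> i)
               + cmat ((b_vec D \<sigma> i \<bullet> x) *\<^sub>R outer (e1 D) (e1 D))
               - cmat (\<Sum>j\<in>UNIV. \<Lambda> $ i $ j *\<^sub>R W_mat D j)))
     \<and> E_mat *v x \<le> f_vec D
     \<and> \<Lambda> \<le> 0}"

text \<open>The suprema and infima below are attained when \<open>Xi D\<close> is nonempty and compact.\<close>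

definition gamma_min :: "('n::finite, 'k::finite, 'l) acopf \<Rightarrow> 'n \<Rightarrow> complex" where
  "gamma_min D i = Complex (SUP \<xi>\<in>Xi D. Re (g_lo D \<xi> $ i)) (SUP \<xi>\<in>Xi D. Im (g_lo D \<xi> $ i))"

definition gamma_max :: "('n::finite, 'k::finite, 'l) acopf \<Rightarrow> 'n \<Rightarrow> complex" where
  "gamma_max D i = Complex (INF \<xi>\<in>Xi D. Re (g_up D \<xi> $ i)) (INF \<xi>\<in>Xi D. Im (g_up D \<xi> $ i))"

definition zero_recourse_feasible :: "('n::finite, 'k::finite, 'l) acopf \<Rightarrow> (complex^'n) set" where
  "zero_recourse_feasible D = {v.
     (\<forall>i. gamma_min D i - demand D $ i \<le>\<^sub>c qform (S_bus D i) v
          \<and> qform (S_bus D i) v \<le>\<^sub>c gamma_max D i - demand D $ i)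
     \<and> (\<forall>i. v_min D $ i \<le> cmod (v $ i) \<and> cmod (v $ i) \<le> v_max D $ i)
     \<and> (\<forall>(i, j)\<in>edges D. complex_of_real (- flow_cap D i j) \<le>\<^sub>c qform (P_line D i j) v
          \<and> qform (P_line D i j) v \<le>\<^sub>c complex_of_real (flow_cap D i j))}"

end

theory Submission
  imports Defs
begin

text \<open>
  The recursion is a majorization-minimization scheme. Completing the square in the majorizer gives

  \<open>H(V, Z) = V\<^sup>H (P + N) V - (V - Z)\<^sup>H N (V - Z)\<close>,

  and \<open>N\<close> is negative semidefinite, so \<open>H(V, V) \<preceq> H(V, Z)\<close> while \<open>H(V, V) = V\<^sup>H A V\<close>
  (\<open>majorizer_eq\<close>, \<open>psd_majorization\<close>). For the constraints this means that a point feasible for the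
  linearization at \<open>Z\<close> stays feasible when the linearization is moved to the point itself
  (\<open>F_set_self\<close>). Every iterate is thus a feasible competitor in the next minimization, whose value
  there is the current cost; and the cost of the minimizer is at most its majorized cost, because
  \<open>Tr(M X) \<ge> 0\<close> for positive semidefinite \<open>X\<close> (\<open>trace_second_moment_nonneg\<close>).

  The substantial part is the start of the induction, \<open>zero_recourse_in_F_set\<close>: a zero-recourse
  solution \<open>v\<^sub>0\<close> must be completed by a dispatch and by multipliers. With the dispatch equal to the
  constant injection plus the demand, each constraint at \<open>V\<^sub>0\<close> asserts that an inequality linear in
  \<open>\<xi>\<close>, valid on all of \<open>\<Xi>\<close>, is certified by multipliers of the inequalities \<open>\<xi>\<^sup>T W\<^sub>j \<xi> \<ge> 0\<close> that define
  \<open>\<Xi>\<close>. On the slice \<open>\<xi>\<^sub>1 = 1\<close> these are concave, since the quadratic block of \<open>W\<^sub>j\<close> is \<open>-\<Omega>\<^sub>j\<^sup>T \<Omega>\<^sub>j\<close>, and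
  a Slater point is given, so Lagrangian duality (\<open>convex_farkas\<close>) provides the multipliers.
\<close>

section \<open>Hermitian matrices and their quadratic forms\<close>

lemma cadj_add: "cadj (A + B) = cadj A + cadj B"
  and cadj_diff: "cadj (A - B) = cadj A - cadj B"
  and cadj_uminus: "cadj (- A) = - cadj A"
  and cadj_cadj: "cadj (cadj A) = A"
  by (simp_all add: cadj_def vec_eq_iff)

lemma cadj_mult: "cadj (A ** B) = cadj B ** cadj A"
  by (simp add: cadj_def matrix_matrix_mult_def vec_eq_iff mult.commute)

lemma hermitian_add: "hermitian A \<Longrightarrow> hermitian B \<Longrightarrow> hermitian (A + B)"
  and hermitian_diff: "hermitian A \<Longrightarrow> hermitian B \<Longrightarrow> hermitian (A - B)"
  and hermitian_uminus: "hermitian A \<Longrightarrow> hermitian (- A)"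
  by (simp_all add: hermitian_def cadj_add cadj_diff cadj_uminus)

lemma hermitian_congruence: "hermitian A \<Longrightarrow> hermitian (cadj V ** A ** V)"
  by (simp add: hermitian_def cadj_mult cadj_cadj matrix_mul_assoc)

lemma qform_altdef: "qform A v = (\<Sum>i\<in>UNIV. cnj (v $ i) * (A *v v) $ i)"
  by (simp add: qform_def matrix_vector_mult_def sum_distrib_left mult.assoc)

lemma qform_add: "qform (A + B) v = qform A v + qform B v"
  and qform_diff: "qform (A - B) v = qform A v - qform B v"
  and qform_uminus: "qform (- A) v = - qform A v"
  by (simp_all add: qform_def sum.distrib sum_subtractf sum_negf algebra_simps)

lemma qform_cscale: "qform (cscale z A) v = z * qform A v"
  by (simp add: qform_def cscale_def sum_distrib_left mult_ac)

lemma qform_cadj: "qform (cadj A) v = cnj (qform A v)"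
proof -
  have "qform (cadj A) v = (\<Sum>j\<in>UNIV. \<Sum>i\<in>UNIV. cnj (v $ i) * cnj (A $ j $ i) * v $ j)"
    unfolding qform_def cadj_def by (subst sum.swap) simp
  then show ?thesis
    by (simp add: qform_def mult_ac)
qed

lemma qform_hermitian:
  assumes "hermitian A"
  shows "qform A v = complex_of_real (Re (qform A v))"
proof -
  have "cnj (qform A v) = qform A v"
    using qform_cadj[of A v] assms by (simp add: hermitian_def)
  then show ?thesis
    by (simp add: complex_eq_iff)
qed

lemma qform_congruence: "qform (cadj V ** A ** V) w = qform A (V *v w)"
proof -
  define y where "y = A *v (V *v w)"
  have "qform (cadj V ** A ** V) w = (\<Sum>a\<in>UNIV. cnj (w $ a) * (cadj V *v y) $ a)"
    by (simp add: qform_altdef matrix_vector_mul_assoc y_def matrix_mul_assoc)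
  also have "\<dots> = (\<Sum>a\<in>UNIV. \<Sum>i\<in>UNIV. cnj (w $ a) * (cnj (V $ i $ a) * y $ i))"
    by (simp add: matrix_vector_mult_def cadj_def sum_distrib_left)
  also have "\<dots> = (\<Sum>i\<in>UNIV. \<Sum>a\<in>UNIV. cnj (w $ a) * (cnj (V $ i $ a) * y $ i))"
    by (rule sum.swap)
  also have "\<dots> = (\<Sum>i\<in>UNIV. cnj ((V *v w) $ i) * y $ i)"
    by (simp add: matrix_vector_mult_def sum_distrib_left sum_distrib_right mult_ac)
  finally show ?thesis
    by (simp add: qform_altdef y_def)
qed

lemma Re_qform_cmat:
  "Re (qform (cmat Q) v) = Re_vec v \<bullet> (Q *v Re_vec v) + Im_vec v \<bullet> (Q *v Im_vec v)"
  by (simp add: qform_def inner_vec_def matrix_vector_mult_def Re_vec_def Im_vec_def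
      sum_distrib_left flip: sum.distrib) (simp add: algebra_simps)

lemma hermitian_cmat: "transpose Q = Q \<Longrightarrow> hermitian (cmat Q)"
  by (simp add: hermitian_def cadj_def vec_eq_iff transpose_def)

lemma nsd_cmatI:
  assumes "transpose Q = Q" and "\<And>y. y \<bullet> (Q *v y) \<le> 0"
  shows "nsd (cmat Q)"
  unfolding nsd_def Re_qform_cmat using assms by (simp add: hermitian_cmat add_nonpos_nonpos)

lemma nsd_mono:
  assumes "nsd Y" and "hermitian X" and "\<And>w. Re (qform X w) \<le> Re (qform Y w)"
  shows "nsd X"
  using assms unfolding nsd_def by (meson order_trans)


section \<open>The majorizers\<close>

lemma matrix_mult_add_left: "(A + B) ** C = A ** C + B ** (C :: 'a::ring_1^'c^'n::finite)"
  and matrix_mult_diff_left: "(A - B) ** C = A ** C - B ** (C :: 'a::ring_1^'c^'n::finite)"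
  and matrix_mult_diff_right: "D ** (E - F) = D ** E - D ** (F :: 'a::ring_1^'c^'n::finite)"
  by (simp_all add: matrix_matrix_mult_def vec_eq_iff sum.distrib sum_subtractf algebra_simps)

text \<open>The majorizer linearizes the concave part \<open>V\<^sup>H N V\<close> of \<open>V\<^sup>H (P + N) V\<close> at \<open>Z\<close>, so its error is
  the second-order term. Both properties that drive the recursion can be read off from this: the
  error is positive semidefinite, and it vanishes at \<open>V = Z\<close>.\<close>

lemma majorizer_eq:
  "majorizer P N V Z = cadj V ** (P + N) ** V - cadj (V - Z) ** N ** (V - Z)"
  by (simp add: majorizer_def cadj_diff matrix_add_ldistrib matrix_mult_add_left
      matrix_mult_diff_left matrix_mult_diff_right algebra_simps)

lemma majorizer_refl: "majorizer P N V V = cadj V ** (P + N) ** V"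
  by (simp add: majorizer_def matrix_add_ldistrib matrix_mult_add_left)

lemma hermitian_majorizer:
  assumes "hermitian P" and "hermitian N"
  shows "hermitian (majorizer P N V Z)"
  unfolding majorizer_eq using assms
  by (intro hermitian_diff hermitian_congruence hermitian_add)

lemma psd_majorization:
  assumes "nsd N"
  shows "psd (majorizer P N V Z - majorizer P N V V)"
proof -
  have "majorizer P N V Z - majorizer P N V V = - (cadj (V - Z) ** N ** (V - Z))"
    by (simp add: majorizer_eq[of P N V Z] majorizer_refl)
  then show ?thesis
    using assms
    by (simp add: psd_def nsd_def hermitian_uminus hermitian_congruence qform_uminus qform_congruence)
qed


section \<open>Convex multipliers\<close>

text \<open>A convex inequality implied by concave inequalities is a consequence of a nonnegative
  combination of them. The attainable pairs of slack vectors and strict upper bounds of \<open>h\<close> form a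
  convex set that misses the origin, and the coefficients of a separating hyperplane are the
  multipliers. The Slater point excludes a vertical hyperplane, on which \<open>h\<close> would have weight 0.\<close>

lemma convex_farkas:
  fixes g :: "'l::finite \<Rightarrow> 'a::real_vector \<Rightarrow> real"
  assumes g: "\<And>j. concave_on S (g j)" and h: "convex_on S h"
    and s: "s \<in> S" "\<And>j. g j s > 0"
    and imp: "\<And>x. x \<in> S \<Longrightarrow> (\<And>j. g j x \<ge> 0) \<Longrightarrow> h x \<ge> 0"
  obtains \<mu> :: "'l \<Rightarrow> real" where "\<And>j. \<mu> j \<ge> 0" "\<And>x. x \<in> S \<Longrightarrow> (\<Sum>j\<in>UNIV. \<mu> j * g j x) \<le> h x"
proof -
  define A :: "((real^'l) \<times> real) set" where
    "A = {(u, t). \<exists>x\<in>S. (\<forall>j. - g j x \<le> u $ j) \<and> h x < t}"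
  have "convex A"
  proof (rule convexI)
    fix p q :: "(real^'l) \<times> real" and a b :: real
    assume p: "p \<in> A" and q: "q \<in> A" and ab: "0 \<le> a" "0 \<le> b" "a + b = 1"
    obtain u t u' t' where pq: "p = (u, t)" "q = (u', t')"
      by fastforce
    obtain x where x: "x \<in> S" "\<And>j. - g j x \<le> u $ j" "h x < t"
      using p pq by (auto simp: A_def)
    obtain y where y: "y \<in> S" "\<And>j. - g j y \<le> u' $ j" "h y < t'"
      using q pq by (auto simp: A_def)
    define z where "z = a *\<^sub>R x + b *\<^sub>R y"
    have "z \<in> S"
      using h x(1) y(1) ab by (auto simp: z_def convex_on_def convex_def)
    moreover have "- g j z \<le> a * u $ j + b * u' $ j" for j
    proof -
      have "a * g j x + b * g j y \<le> g j z"
        using g[of j] x(1) y(1) ab unfolding concave_on_iff z_def by blast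
      moreover have "a * - g j x \<le> a * u $ j" "b * - g j y \<le> b * u' $ j"
        using x(2)[of j] y(2)[of j] ab by (intro mult_left_mono; simp)+
      ultimately show ?thesis
        by simp
    qed
    moreover have "h z < a * t + b * t'"
    proof -
      have "h z \<le> a * h x + b * h y"
        using h x(1) y(1) ab unfolding convex_on_def z_def by blast
      also have "\<dots> < a * t + b * t'"
      proof (cases "a = 0")
        case True
        then show ?thesis using ab y by simp
      next
        case False
        then have "a * h x < a * t" "b * h y \<le> b * t'"
          using ab x y by (auto intro: mult_left_mono)
        then show ?thesis by simp
      qed
      finally show ?thesis .
    qed
    ultimately show "a *\<^sub>R p + b *\<^sub>R q \<in> A"
      by (auto simp: A_def pq)
  qed
  moreover have "0 \<notin> A"
    using imp by (force simp: A_def zero_prod_def)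
  ultimately obtain c where c: "c \<noteq> 0" "\<forall>z\<in>A. 0 \<le> c \<bullet> z"
    using separating_hyperplane_set_0 by blast
  obtain l m where lm: "c = (l, m)"
    by fastforce
  have sep: "0 \<le> l \<bullet> u + m * t" if "x \<in> S" "\<And>j. - g j x \<le> u $ j" "h x < t" for x u t
    using c(2) that by (force simp: A_def lm)
  \<comment> \<open>The attainable set is closed under increasing any coordinate, so no coefficient of the
    hyperplane is negative: otherwise a large enough coordinate makes the functional negative.\<close>
  have m: "m \<ge> 0"
  proof (rule ccontr)
    assume "\<not> m \<ge> 0"
    define B where "B = l \<bullet> (\<chi> j. - g j s)"
    define t where "t = max (h s + 1) ((\<bar>B\<bar> + 1) / - m)"
    have "0 \<le> B + m * t"
      unfolding B_def by (rule sep[OF s(1)]) (auto simp: t_def)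
    moreover have "(\<bar>B\<bar> + 1) / - m \<le> t"
      by (simp add: t_def)
    then have "\<bar>B\<bar> + 1 \<le> t * - m"
      using \<open>\<not> m \<ge> 0\<close> by (subst (asm) pos_divide_le_eq) auto
    ultimately show False
      by (simp add: algebra_simps)
  qed
  have l: "l $ j \<ge> 0" for j
  proof (rule ccontr)
    assume neg: "\<not> l $ j \<ge> 0"
    define B where "B = l \<bullet> (\<chi> j. - g j s) + m * (h s + 1)"
    define r where "r = (\<bar>B\<bar> + 1) / - l $ j"
    have "r \<ge> 0"
      using neg unfolding r_def by (intro divide_nonneg_pos) auto
    then have "0 \<le> l \<bullet> ((\<chi> j. - g j s) + axis j r) + m * (h s + 1)"
      by (intro sep[OF s(1)]) (auto simp: axis_def)
    then have "0 \<le> B + l $ j * r"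
      by (simp add: B_def inner_add_right inner_axis)
    moreover have "l $ j * r = - (\<bar>B\<bar> + 1)"
      using neg by (simp add: r_def field_simps)
    ultimately show False
      by simp
  qed
  \<comment> \<open>The bound \<open>t > h x\<close> is strict, so \<open>h x\<close> itself is reached in the limit. Dividing the error by
    \<open>m + 1\<close> avoids a division by 0 while \<open>m = 0\<close> is still possible.\<close>
  have lag: "0 \<le> l \<bullet> (\<chi> j. - g j x) + m * h x" if x: "x \<in> S" for x
  proof (rule field_le_epsilon)
    fix e :: real assume "e > 0"
    define d where "d = e / (m + 1)"
    have "0 < d" "m * d \<le> e"
      using \<open>e > 0\<close> m by (auto simp: d_def field_simps)
    moreover have "0 \<le> l \<bullet> (\<chi> j. - g j x) + m * (h x + d)"
      using \<open>0 < d\<close> by (intro sep[OF x]) auto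
    ultimately show "0 \<le> l \<bullet> (\<chi> j. - g j x) + m * h x + e"
      by (simp add: algebra_simps)
  qed
  have "m \<noteq> 0"
  proof
    assume "m = 0"
    then have "(\<Sum>j\<in>UNIV. l $ j * g j s) \<le> 0"
      using lag[OF s(1)] by (simp add: inner_vec_def sum_negf)
    moreover have nn: "0 \<le> l $ j * g j s" for j
      using l s(2)[of j] by (simp add: less_imp_le)
    ultimately have "(\<Sum>j\<in>UNIV. l $ j * g j s) = 0"
      by (simp add: antisym sum_nonneg)
    then have "\<forall>j. l $ j * g j s = 0"
      using nn by (subst (asm) sum_nonneg_eq_0_iff) auto
    then have "l = 0"
      using s(2) by (metis mult_eq_0_iff less_irrefl vec_eq_iff zero_index)
    then show False
      using c(1) lm \<open>m = 0\<close> by (simp add: zero_prod_def)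
  qed
  then have "m > 0"
    using m by simp
  show thesis
  proof
    show "l $ j / m \<ge> 0" for j
      using l m by simp
    show "(\<Sum>j\<in>UNIV. l $ j / m * g j x) \<le> h x" if "x \<in> S" for x
    proof -
      have "(\<Sum>j\<in>UNIV. l $ j * g j x) \<le> m * h x"
        using lag[OF that] by (simp add: inner_vec_def sum_negf)
      then have "(\<Sum>j\<in>UNIV. l $ j * g j x) / m \<le> h x"
        using \<open>m > 0\<close> by (simp add: field_simps)
      then show ?thesis
        by (simp add: sum_divide_distrib)
    qed
  qed
qed

text \<open>On an affine hyperplane a quadratic form is as concave as it is negative on the directions of
  that hyperplane: the gap between the value at a convex combination of \<open>x\<close> and \<open>y\<close> and the
  combination of the values is a negative multiple of the form at \<open>x - y\<close>.\<close>

lemma concave_on_slice: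
  fixes W :: "real^'k^'k"
  assumes "\<And>y. y $ i = 0 \<Longrightarrow> y \<bullet> (W *v y) \<le> 0"
  shows "concave_on {y. y $ i = 1} (\<lambda>y. y \<bullet> (W *v y))"
  unfolding concave_on_iff
proof (intro conjI ballI allI impI)
  show "convex {y :: real^'k. y $ i = 1}"
    by (auto simp: convex_def)
next
  fix x y :: "real^'k" and u v :: real
  assume x: "x \<in> {y. y $ i = 1}" and y: "y \<in> {y. y $ i = 1}" and uv: "0 \<le> u" "0 \<le> v" "u + v = 1"
  have u: "u = 1 - v"
    using uv by simp
  define q where "q y = y \<bullet> (W *v y)" for y
  have "q (u *\<^sub>R x + v *\<^sub>R y) = u * q x + v * q y - u * v * q (x - y)"
    by (simp add: q_def u algebra_simps inner_add_left inner_add_right inner_diff_left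
        inner_diff_right)
  moreover have "u * v * q (x - y) \<le> 0"
    using x y uv by (intro mult_nonneg_nonpos) (auto simp: q_def intro: assms)
  ultimately show "u * (x \<bullet> (W *v x)) + v * (y \<bullet> (W *v y))
      \<le> (u *\<^sub>R x + v *\<^sub>R y) \<bullet> (W *v (u *\<^sub>R x + v *\<^sub>R y))"
    by (simp add: q_def)
qed

lemma quadratic_form_expand:
  fixes W :: "real^'k^'k"
  shows "y \<bullet> (W *v y) = (\<Sum>a\<in>UNIV. \<Sum>b\<in>UNIV. y $ a * (W $ a $ b * y $ b))"
  by (simp add: inner_vec_def matrix_vector_mult_def sum_distrib_left)

lemma W_mat_nonpos:
  fixes D :: "('n::finite, 'k::finite, 'l) acopf"
  assumes y: "y $ fst_idx D = 0"
  shows "y \<bullet> (W_mat D j *v y) \<le> 0"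
proof -
  have "y \<bullet> (W_mat D j *v y)
      = (\<Sum>a\<in>UNIV. \<Sum>b\<in>UNIV. - (\<Sum>r<Om_rows D j. (Om_cf D j r a * y $ a) * (Om_cf D j r b * y $ b)))"
    unfolding quadratic_form_expand
    by (intro sum.cong refl) (auto simp: W_mat_def y sum_distrib_left sum_distrib_right mult_ac)
  also have "\<dots> = - (\<Sum>r<Om_rows D j. \<Sum>a\<in>UNIV. \<Sum>b\<in>UNIV. (Om_cf D j r a * y $ a) * (Om_cf D j r b * y $ b))"
    by (simp add: sum_negf sum.swap[of _ "{..<Om_rows D j}"])
  also have "\<dots> = - (\<Sum>r<Om_rows D j. (\<Sum>a\<in>UNIV. Om_cf D j r a * y $ a)\<^sup>2)"
    by (simp add: power2_eq_square sum_product)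
  also have "\<dots> \<le> 0"
    by (simp add: sum_nonneg)
  finally show ?thesis .
qed

text \<open>The multipliers turn a linear inequality on \<open>\<Xi>\<close> into a quadratic inequality on the slice
  \<open>y\<^sub>1 = 1\<close>. Its homogeneous form extends to \<open>y\<^sub>1 \<noteq> 0\<close> by scaling and to \<open>y\<^sub>1 = 0\<close> by continuity,
  which makes it a matrix inequality.\<close>

lemma linear_lower_bound_multipliers:
  fixes D :: "('n::finite, 'k::finite, 'l::finite) acopf"
  assumes slater: "\<zeta> \<in> Xi D" "\<And>j. \<zeta> \<bullet> (W_mat D j *v \<zeta>) > 0"
    and lower: "\<And>\<eta>. \<eta> \<in> Xi D \<Longrightarrow> \<kappa> \<le> c \<bullet> \<eta>"
  obtains \<mu> :: "'l \<Rightarrow> real" where "\<And>j. \<mu> j \<ge> 0"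
    and "\<And>y. \<kappa> * (y $ fst_idx D)\<^sup>2 + (\<Sum>j\<in>UNIV. \<mu> j * (y \<bullet> (W_mat D j *v y)))
           \<le> y $ fst_idx D * (c \<bullet> y)"
proof -
  let ?i = "fst_idx D"
  let ?S = "{y :: real^'k. y $ ?i = 1}"
  have conv: "convex ?S"
    using concave_on_slice[of ?i 0] by (simp add: concave_on_iff)
  obtain \<mu> :: "'l \<Rightarrow> real" where nn: "\<And>j. \<mu> j \<ge> 0"
    and bound: "\<And>y. y \<in> ?S \<Longrightarrow> (\<Sum>j\<in>UNIV. \<mu> j * (y \<bullet> (W_mat D j *v y))) \<le> c \<bullet> y - \<kappa>"
  proof (rule convex_farkas[of ?S "\<lambda>j y. y \<bullet> (W_mat D j *v y)" "\<lambda>y. c \<bullet> y - \<kappa>" \<zeta>])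
    show "concave_on ?S (\<lambda>y. y \<bullet> (W_mat D j *v y))" for j
      by (intro concave_on_slice W_mat_nonpos)
    show "convex_on ?S (\<lambda>y. c \<bullet> y - \<kappa>)"
    proof -
      have "c \<bullet> (u *\<^sub>R y + v *\<^sub>R z) - \<kappa> = u * (c \<bullet> y - \<kappa>) + v * (c \<bullet> z - \<kappa>)"
        if "u + v = 1" for u v y z
      proof -
        have u: "u = 1 - v"
          using that by simp
        show ?thesis
          unfolding u by (simp add: inner_add_right algebra_simps)
      qed
      then show ?thesis
        unfolding convex_on_def using conv by simp
    qed
  qed (use slater lower in \<open>auto simp: Xi_def\<close>)
  define F where
    "F y = y $ ?i * (c \<bullet> y) - \<kappa> * (y $ ?i)\<^sup>2 - (\<Sum>j\<in>UNIV. \<mu> j * (y \<bullet> (W_mat D j *v y)))" for y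
  have slice: "F y \<ge> 0" if "y $ ?i = 1" for y
    using bound[of y] that by (simp add: F_def)
  have scale: "F (t *\<^sub>R y) = t\<^sup>2 * F y" for t y
    by (simp add: F_def power2_eq_square matrix_vector_mult_scaleR sum_distrib_left algebra_simps)
  have off: "F y \<ge> 0" if "y $ ?i \<noteq> 0" for y
  proof -
    have "F y = (y $ ?i)\<^sup>2 * F ((1 / y $ ?i) *\<^sub>R y)"
      using that scale[of "y $ ?i" "(1 / y $ ?i) *\<^sub>R y"] by simp
    then show ?thesis
      using slice[of "(1 / y $ ?i) *\<^sub>R y"] that by simp
  qed
  have all: "F y \<ge> 0" for y
  proof (cases "y $ ?i = 0")
    case True
    define f where "f t = F (y + t *\<^sub>R axis ?i 1)" for t
    have "continuous_on UNIV f"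
      unfolding f_def F_def
      by (intro continuous_intros bounded_linear.continuous_on[OF matrix_vector_mul_bounded_linear])
    then have "isCont f 0"
      by (simp add: continuous_on_eq_continuous_at)
    then have "(f \<longlongrightarrow> f 0) (at_right 0)"
      by (simp add: isCont_def filterlim_at_split)
    moreover have "\<forall>\<^sub>F t in at_right 0. 0 \<le> f t"
      unfolding f_def using True by (intro eventually_mono[OF eventually_at_right_less] off) auto
    ultimately have "0 \<le> f 0"
      by (rule tendsto_lowerbound) simp
    then show ?thesis
      by (simp add: f_def)
  qed (rule off)
  show thesis
    by (rule that[of \<mu>]) (use nn all in \<open>auto simp: F_def algebra_simps\<close>)
qed


section \<open>The second-moment matrix\<close>

text \<open>The complement of the support is a union of null sets, and a countable basis makes it a
  countable one.\<close>

lemma (in prob_space) AE_rv_support: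
  fixes X :: "'a \<Rightarrow> 'b::second_countable_topology"
  assumes X: "X \<in> borel_measurable M"
  shows "AE \<omega> in M. X \<omega> \<in> rv_support M X"
proof -
  obtain B :: "'b set set" where B: "countable B" "topological_basis B"
    using ex_countable_basis by blast
  define N where "N = {b \<in> B. prob (X -` b \<inter> space M) = 0}"
  have "countable N"
    using B(1) by (simp add: N_def)
  moreover have "AE \<omega> in M. X \<omega> \<notin> b" if "b \<in> N" for b
  proof -
    have "open b"
      using that B(2) by (auto simp: N_def topological_basis_open)
    then have "X -` b \<inter> space M \<in> events"
      using X by (simp add: measurable_sets)
    then have "X -` b \<inter> space M \<in> null_sets M"
      using that by (simp add: N_def null_setsI emeasure_eq_measure)
    from AE_not_in[OF this] show ?thesis
      using AE_space by eventually_elim auto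
  qed
  ultimately have "AE \<omega> in M. \<forall>b\<in>N. X \<omega> \<notin> b"
    by (simp add: AE_ball_countable)
  then show ?thesis
  proof eventually_elim
    case (elim \<omega>)
    have "prob (X -` U \<inter> space M) > 0" if U: "open U" "X \<omega> \<in> U" for U
    proof -
      obtain b where b: "b \<in> B" "X \<omega> \<in> b" "b \<subseteq> U"
        using topological_basisE[OF B(2) U] by blast
      have "0 < prob (X -` b \<inter> space M)"
        using elim b by (auto simp: N_def zero_less_measure_iff)
      also have "\<dots> \<le> prob (X -` U \<inter> space M)"
        using b(3) U(1) X by (intro finite_measure_mono) (auto simp: measurable_sets)
      finally show ?thesis .
    qed
    then show ?case
      by (auto simp: rv_support_def)
  qed
qed

text \<open>The trace is the expectation of \<open>\<xi>\<^sup>T X \<xi>\<close>. Boundedness of the support is what makes the second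
  moments genuine integrals: the Bochner integral of a non-integrable function is 0, so without
  integrability the matrix of second moments need not be positive semidefinite.\<close>

lemma (in prob_space) trace_second_moment_nonneg:
  fixes \<xi> :: "'a \<Rightarrow> real^'k"
  assumes \<xi>: "\<xi> \<in> borel_measurable M" and bdd: "bounded (rv_support M \<xi>)" and X: "psd X"
  shows "Re (trace (cmat (second_moment M \<xi>) ** X)) \<ge> 0"
proof -
  obtain R where R: "\<And>y. y \<in> rv_support M \<xi> \<Longrightarrow> norm y \<le> R"
    using bdd by (auto simp: bounded_iff)
  have int: "integrable M (\<lambda>\<omega>. \<xi> \<omega> $ a * \<xi> \<omega> $ b)" for a b
  proof (rule integrable_const_bound)
    show "AE \<omega> in M. norm (\<xi> \<omega> $ a * \<xi> \<omega> $ b) \<le> R * R"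
      using AE_rv_support[OF \<xi>]
    proof eventually_elim
      case (elim \<omega>)
      have "\<bar>\<xi> \<omega> $ i\<bar> \<le> R" for i
        using R[OF elim] component_le_norm_cart[of "\<xi> \<omega>" i] by simp
      then show ?case
        by (auto simp: abs_mult intro!: mult_mono order_trans[OF abs_ge_zero])
    qed
    have "(\<lambda>\<omega>. \<xi> \<omega> $ i) \<in> borel_measurable M" for i
      by (rule measurable_compose[OF \<xi>])
        (intro borel_measurable_continuous_onI continuous_intros)
    then show "(\<lambda>\<omega>. \<xi> \<omega> $ a * \<xi> \<omega> $ b) \<in> borel_measurable M"
      by simp
  qed
  have "Re (trace (cmat (second_moment M \<xi>) ** X))
      = (\<Sum>a\<in>UNIV. \<Sum>b\<in>UNIV. (\<integral>\<omega>. \<xi> \<omega> $ a * \<xi> \<omega> $ b \<partial>M) * Re (X $ b $ a))"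
    by (simp add: trace_def matrix_matrix_mult_def second_moment_def)
  also have "\<dots> = (\<Sum>b\<in>UNIV. \<Sum>a\<in>UNIV. (\<integral>\<omega>. \<xi> \<omega> $ a * \<xi> \<omega> $ b \<partial>M) * Re (X $ b $ a))"
    by (rule sum.swap)
  also have "\<dots> = (\<integral>\<omega>. (\<Sum>b\<in>UNIV. \<Sum>a\<in>UNIV. (\<xi> \<omega> $ a * \<xi> \<omega> $ b) * Re (X $ b $ a)) \<partial>M)"
    using int by simp
  also have "\<dots> = (\<integral>\<omega>. Re (qform X (cvec (\<xi> \<omega>))) \<partial>M)"
    by (simp add: qform_def cvec_def mult_ac)
  also have "\<dots> \<ge> 0"
    using X by (simp add: psd_def)
  finally show ?thesis .
qed


section \<open>The zero-recourse starting point\<close>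

text \<open>A zero-recourse solution injects the same power for every \<open>\<xi>\<close>, so the constraints reduce to
  scalar inequalities; setting the day-ahead generation to this constant injection plus the demand
  leaves no real-time adjustment for the ramp limits to restrict.\<close>

definition injection_dispatch :: "('n::finite, 'k::finite, 'l) acopf \<Rightarrow> complex^'n \<Rightarrow> real^('n + 'n)"
  where "injection_dispatch D v = (\<chi> r. case r of
      Inl i \<Rightarrow> Re (qform (S_bus D i) v + demand D $ i)
    | Inr i \<Rightarrow> Im (qform (S_bus D i) v + demand D $ i))"

lemma qform_Phi: "qform (Phi D i) v = complex_of_real (Re (qform (S_bus D i) v))"
  by (simp add: Phi_def qform_cscale qform_add qform_cadj complex_eq_iff)

lemma qform_Psi: "qform (Psi D i) v = complex_of_real (Im (qform (S_bus D i) v))"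
  by (simp add: Psi_def qform_cscale qform_diff qform_cadj complex_eq_iff Re_divide Im_divide
      power2_eq_square)

lemma qform_outer_axis:
  "qform (outer (axis i 1) (axis i 1)) v = complex_of_real ((cmod (v $ i))\<^sup>2)"
proof -
  have "qform (outer (axis i 1) (axis i 1)) v
      = (\<Sum>a\<in>UNIV. \<Sum>b\<in>UNIV. if a = i then if b = i then cnj (v $ i) * v $ i else 0 else 0)"
    unfolding qform_def outer_def axis_def by (intro sum.cong refl) auto
  also have "\<dots> = (\<Sum>a\<in>UNIV. if a = i then \<Sum>b\<in>UNIV. if b = i then cnj (v $ i) * v $ i else 0 else 0)"
    by (intro sum.cong refl) simp
  also have "\<dots> = cnj (v $ i) * v $ i"
    by simp
  finally show ?thesis
    by (simp only: complex_norm_square mult.commute)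
qed

lemma Xi_fst: "\<zeta> \<in> Xi D \<Longrightarrow> \<zeta> $ fst_idx D = 1"
  by (simp add: Xi_def)

lemma inner_e1: "(e1 D :: real^'k) \<bullet> y = y $ fst_idx D"
  for D :: "('n::finite, 'k::finite, 'l) acopf"
  by (simp add: e1_def inner_axis inner_commute)

lemma inner_smult_e1: "((s *s e1 D) :: real^'k) \<bullet> y = s * y $ fst_idx D"
  for D :: "('n::finite, 'k::finite, 'l) acopf"
  using inner_e1[of D y] by (simp add: inner_vec_def sum_distrib_left mult.assoc flip: sum_distrib_left)

lemma inner_Re_vec_diff: "Re_vec (u - w) \<bullet> y = Re_vec u \<bullet> y - Re_vec w \<bullet> y"
  and inner_Im_vec_diff: "Im_vec (u - w) \<bullet> y = Im_vec u \<bullet> y - Im_vec w \<bullet> y"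
  by (simp_all add: Re_vec_def Im_vec_def inner_vec_def sum_subtractf algebra_simps)

lemma inner_Re_vec_transpose: "Re_vec (transpose G *v axis i 1) \<bullet> y = Re ((G *v cvec y) $ i)"
  and inner_Im_vec_transpose: "Im_vec (transpose G *v axis i 1) \<bullet> y = Im ((G *v cvec y) $ i)"
  by (simp_all add: Re_vec_def Im_vec_def inner_vec_def matrix_vector_mult_def transpose_def
      cvec_def axis_def if_distrib sum.delta cong: if_cong)

lemma Re_vec_smult_e1: "Re_vec (z *s e1 D) = Re z *s e1 D"
  and Im_vec_smult_e1: "Im_vec (z *s e1 D) = Im z *s e1 D"
  by (simp_all add: Re_vec_def Im_vec_def vec_eq_iff e1_def axis_def)

text \<open>The capacity limits bound the available generation on \<open>\<Xi>\<close>, which makes the supremum and the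
  infimum in \<open>\<gamma>\<close> actual bounds.\<close>

lemma gamma_bounds:
  fixes D :: "('n::finite, 'k::finite, 'l) acopf"
  assumes cap: "\<forall>\<zeta>\<in>Xi D. \<forall>i. g_min D $ i \<le>\<^sub>c g_lo D \<zeta> $ i
           \<and> g_lo D \<zeta> $ i \<le>\<^sub>c g_up D \<zeta> $ i \<and> g_up D \<zeta> $ i \<le>\<^sub>c g_max D $ i"
    and \<zeta>: "\<zeta> \<in> Xi D"
  shows "g_lo D \<zeta> $ i \<le>\<^sub>c gamma_min D i" and "gamma_max D i \<le>\<^sub>c g_up D \<zeta> $ i"
proof -
  have lo: "g_lo D \<eta> $ i \<le>\<^sub>c g_max D $ i" and up: "g_min D $ i \<le>\<^sub>c g_up D \<eta> $ i"
    if "\<eta> \<in> Xi D" for \<eta>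
    using cap[rule_format, OF that, of i] by (auto simp: cle_def)
  have "bdd_above ((\<lambda>\<xi>. Re (g_lo D \<xi> $ i)) ` Xi D)"
    by (rule bdd_aboveI2[where M = "Re (g_max D $ i)"]) (use lo in \<open>simp add: cle_def\<close>)
  moreover have "bdd_above ((\<lambda>\<xi>. Im (g_lo D \<xi> $ i)) ` Xi D)"
    by (rule bdd_aboveI2[where M = "Im (g_max D $ i)"]) (use lo in \<open>simp add: cle_def\<close>)
  ultimately show "g_lo D \<zeta> $ i \<le>\<^sub>c gamma_min D i"
    using \<zeta> by (auto simp: cle_def gamma_min_def intro: cSUP_upper)
  have "bdd_below ((\<lambda>\<xi>. Re (g_up D \<xi> $ i)) ` Xi D)"
    by (rule bdd_belowI2[where m = "Re (g_min D $ i)"]) (use up in \<open>simp add: cle_def\<close>)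
  moreover have "bdd_below ((\<lambda>\<xi>. Im (g_up D \<xi> $ i)) ` Xi D)"
    by (rule bdd_belowI2[where m = "Im (g_min D $ i)"]) (use up in \<open>simp add: cle_def\<close>)
  ultimately show "gamma_max D i \<le>\<^sub>c g_up D \<zeta> $ i"
    using \<zeta> by (auto simp: cle_def gamma_max_def intro: cINF_lower)
qed

lemma zero_recourse_injection:
  assumes "v \<in> zero_recourse_feasible D"
  shows "gamma_min D i - demand D $ i \<le>\<^sub>c qform (S_bus D i) v"
    and "qform (S_bus D i) v \<le>\<^sub>c gamma_max D i - demand D $ i"
  using assms by (simp_all add: zero_recourse_feasible_def)

text \<open>The range \<open>[\<gamma>\<^sup>m\<^sup>i\<^sup>n, \<gamma>\<^sup>m\<^sup>a\<^sup>x]\<close> lies inside the real-time capacity range of every scenario, and the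
  adjustment relative to the dispatch is 0, which the ramp limits permit.\<close>

lemma zero_recourse_scalar:
  fixes D :: "('n::finite, 'k::finite, 'l) acopf"
  assumes cap: "\<forall>\<zeta>\<in>Xi D. \<forall>i. g_min D $ i \<le>\<^sub>c g_lo D \<zeta> $ i
           \<and> g_lo D \<zeta> $ i \<le>\<^sub>c g_up D \<zeta> $ i \<and> g_up D \<zeta> $ i \<le>\<^sub>c g_max D $ i"
    and ramp: "\<forall>i. r_min D $ i \<le>\<^sub>c 0 \<and> 0 \<le>\<^sub>c r_max D $ i"
    and vmin: "\<forall>i. v_min D $ i \<ge> 0"
    and v: "v \<in> zero_recourse_feasible D"
    and \<zeta>: "\<zeta> \<in> Xi D"
    and k: "k \<in> con_set (edges D)"
    and data: "con_data D k = (A, b, c)"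
  shows "Re (qform A v) + b \<bullet> injection_dispatch D v \<le> c \<bullet> \<zeta>"
proof -
  note simps = qform_Phi qform_Psi qform_uminus qform_outer_axis inner_smult_e1 Xi_fst[OF \<zeta>]
    inner_Re_vec_diff inner_Im_vec_diff inner_Re_vec_transpose inner_Im_vec_transpose
    Re_vec_smult_e1 Im_vec_smult_e1 injection_dispatch_def inner_axis' cle_def
    inner_diff_left inner_minus_left
  have up: "qform (S_bus D i) v \<le>\<^sub>c g_up D \<zeta> $ i - demand D $ i"
    and lo: "g_lo D \<zeta> $ i - demand D $ i \<le>\<^sub>c qform (S_bus D i) v" for i
    using zero_recourse_injection[OF v, of i] gamma_bounds[OF cap \<zeta>, of i] by (auto simp: cle_def)
  have volt: "(cmod (v $ i))\<^sup>2 \<le> (v_max D $ i)\<^sup>2" "(v_min D $ i)\<^sup>2 \<le> (cmod (v $ i))\<^sup>2" for i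
    using v vmin by (auto simp: zero_recourse_feasible_def intro!: power_mono)
  have flow: "- flow_cap D i j \<le> Re (qform (P_line D i j) v)"
    "Re (qform (P_line D i j) v) \<le> flow_cap D i j" if "(i, j) \<in> edges D" for i j
    using v that by (auto simp: zero_recourse_feasible_def cle_def)
  show ?thesis
  proof (cases k)
    case (PCapUp i)
    then show ?thesis using data up[of i] by (auto simp: simps g_up_def simp del: transpose_matrix_vector)
  next
    case (PCapLo i)
    then show ?thesis using data lo[of i] by (auto simp: simps g_lo_def simp del: transpose_matrix_vector)
  next
    case (QCapUp i)
    then show ?thesis using data up[of i] by (auto simp: simps g_up_def simp del: transpose_matrix_vector)
  next
    case (QCapLo i)
    then show ?thesis using data lo[of i] by (auto simp: simps g_lo_def simp del: transpose_matrix_vector)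
  next
    case (PRampUp i)
    then show ?thesis using data ramp by (auto simp: simps)
  next
    case (PRampLo i)
    then show ?thesis using data ramp by (auto simp: simps)
  next
    case (QRampUp i)
    then show ?thesis using data ramp by (auto simp: simps)
  next
    case (QRampLo i)
    then show ?thesis using data ramp by (auto simp: simps)
  next
    case (VoltUp i)
    then show ?thesis using data volt[of i] by (auto simp: simps simp del: of_real_power)
  next
    case (VoltLo i)
    then show ?thesis using data volt[of i] by (auto simp: simps simp del: of_real_power)
  next
    case (FlowUp i j)
    then have "(i, j) \<in> edges D" using k by (auto simp: con_set_def)
    then show ?thesis using FlowUp data flow[of i j] by (auto simp: simps)
  next
    case (FlowLo i j)
    then have "(i, j) \<in> edges D" using k by (auto simp: con_set_def)
    then show ?thesis using FlowLo data flow[of i j] by (auto simp: simps)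
  qed
qed

lemma injection_dispatch_capacity:
  fixes D :: "('n::finite, 'k::finite, 'l) acopf"
  assumes cap: "\<forall>\<zeta>\<in>Xi D. \<forall>i. g_min D $ i \<le>\<^sub>c g_lo D \<zeta> $ i
           \<and> g_lo D \<zeta> $ i \<le>\<^sub>c g_up D \<zeta> $ i \<and> g_up D \<zeta> $ i \<le>\<^sub>c g_max D $ i"
    and \<zeta>: "\<zeta> \<in> Xi D"
    and v: "v \<in> zero_recourse_feasible D"
  shows "E_mat *v injection_dispatch D v \<le> f_vec D"
proof -
  have up: "qform (S_bus D i) v + demand D $ i \<le>\<^sub>c g_max D $ i"
    and lo: "g_min D $ i \<le>\<^sub>c qform (S_bus D i) v + demand D $ i" for i
    using zero_recourse_injection[OF v, of i] gamma_bounds[OF cap \<zeta>, of i]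
      cap[rule_format, OF \<zeta>, of i] by (auto simp: cle_def)
  have E: "(E_mat *v x) $ r = (case r of Inl a \<Rightarrow> x $ a | Inr a \<Rightarrow> - x $ a)" for x :: "real^('n + 'n)" and r
    by (cases r) (simp_all add: matrix_vector_mult_def E_mat_def mat_def if_distrib sum_negf
        if_distribR sum.delta cong: if_cong)
  note simps = E f_vec_def injection_dispatch_def cle_def
  show ?thesis
    unfolding less_eq_vec_def
  proof
    fix r :: "('n + 'n) + ('n + 'n)"
    consider i where "r = Inl (Inl i)" | i where "r = Inl (Inr i)"
      | i where "r = Inr (Inl i)" | i where "r = Inr (Inr i)"
      by (metis sum.exhaust)
    then show "(E_mat *v injection_dispatch D v) $ r \<le> f_vec D $ r"
    proof cases
      case (1 i)
      then show ?thesis using up[of i] by (simp add: simps)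
    next
      case (2 i)
      then show ?thesis using up[of i] by (simp add: simps)
    next
      case (3 i)
      then show ?thesis using lo[of i] by (simp add: simps)
    next
      case (4 i)
      then show ?thesis using lo[of i] by (simp add: simps)
    qed
  qed
qed

lemma congruence_outer:
  "cadj (outer v (e1 D)) ** A ** outer v (e1 D) = cscale (qform A v) (outer (e1 D) (e1 D))"
proof -
  have "(\<Sum>i\<in>UNIV. (\<Sum>a\<in>UNIV. cnj (v $ a) * A $ a $ i) * v $ i) = qform A v"
    unfolding qform_def by (simp add: sum_distrib_right) (rule sum.swap)
  then show ?thesis
    by (auto simp: vec_eq_iff matrix_matrix_mult_def cadj_def outer_def cscale_def e1_def axis_def)
qed

lemma inner_outer_mult: "y \<bullet> (outer u w *v y) = (u \<bullet> y) * (w \<bullet> y)"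
  for y :: "real^'k"
  unfolding quadratic_form_expand
  by (simp add: outer_def inner_vec_def sum_product mult_ac)

lemma inner_sum_scaleR_mult:
  fixes B :: "'l::finite \<Rightarrow> real^'k^'k"
  shows "y \<bullet> ((\<Sum>j\<in>UNIV. s j *\<^sub>R B j) *v y) = (\<Sum>j\<in>UNIV. s j * (y \<bullet> (B j *v y)))"
proof -
  have "(\<Sum>j\<in>UNIV. s j *\<^sub>R B j) *v y = (\<Sum>j\<in>UNIV. s j *\<^sub>R (B j *v y))"
    by (simp add: linear_sum[of "\<lambda>B. B *v y"] linear_iff matrix_vector_mult_add_rdistrib
        scaleR_matrix_vector_assoc)
  then show ?thesis
    by (simp add: inner_sum_right)
qed

lemma transpose_W_mat: "transpose (W_mat D j) = W_mat D j"
  by (auto simp: W_mat_def transpose_def vec_eq_iff mult.commute)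

lemma transpose_C_mat: "transpose (C_mat D \<sigma> i) = C_mat D \<sigma> i"
  by (simp add: C_mat_def outer_def transpose_def vec_eq_iff mult.commute)

lemma transpose_outer_self: "transpose (outer u u) = outer u (u :: real^'k)"
  by (simp add: outer_def transpose_def vec_eq_iff mult.commute)

text \<open>Since \<open>V\<^sub>0 \<xi> = \<xi>\<^sub>1 v\<^sub>0\<close>, the majorizer at \<open>V\<^sub>0\<close> is a real multiple of \<open>e\<^sub>1 e\<^sub>1\<^sup>T\<close>. Each constraint
  matrix is therefore real, and on the slice \<open>\<xi>\<^sub>1 = 1\<close> its constraint says that a linear function minus a constant dominates a nonnegative combination of the
  forms \<open>\<xi>\<^sup>T W\<^sub>j \<xi>\<close>; the multipliers of the scalar inequality supply such a combination.\<close>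

lemma zero_recourse_in_F_set:
  fixes D :: "('n::finite, 'k::finite, 'l::finite) acopf" and \<sigma> :: "'m::finite \<Rightarrow> 'n con"
  assumes slater: "\<zeta> \<in> Xi D" "\<And>j. \<zeta> \<bullet> (W_mat D j *v \<zeta>) > 0"
    and ramp: "\<forall>i. r_min D $ i \<le>\<^sub>c 0 \<and> 0 \<le>\<^sub>c r_max D $ i"
    and vmin: "\<forall>i. v_min D $ i \<ge> 0"
    and cap: "\<forall>\<zeta>\<in>Xi D. \<forall>i. g_min D $ i \<le>\<^sub>c g_lo D \<zeta> $ i
           \<and> g_lo D \<zeta> $ i \<le>\<^sub>c g_up D \<zeta> $ i \<and> g_up D \<zeta> $ i \<le>\<^sub>c g_max D $ i"
    and \<sigma>: "range \<sigma> \<subseteq> con_set (edges D)"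
    and parts: "\<And>i. semidef_parts (A_mat D \<sigma> (Some i)) (Ap (Some i)) (An (Some i))"
    and v: "v \<in> zero_recourse_feasible D"
  obtains \<Lambda> where "(injection_dispatch D v, outer v (e1 D), \<Lambda>) \<in> F_set D \<sigma> Ap An (outer v (e1 D))"
proof -
  let ?x = "injection_dispatch D v" and ?V = "outer v (e1 D)"
  let ?E = "outer (e1 D) (e1 D) :: real^'k^'k"
  define \<kappa> where "\<kappa> i = Re (qform (A_mat D \<sigma> (Some i)) v) + b_vec D \<sigma> i \<bullet> ?x" for i
  have scalar: "\<kappa> i \<le> c_vec D \<sigma> i \<bullet> \<eta>" if "\<eta> \<in> Xi D" for i \<eta>
    unfolding \<kappa>_def A_mat.simps
    using \<sigma> by (intro zero_recourse_scalar[OF cap ramp vmin v that, of "\<sigma> i"])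
      (auto simp: b_vec_def c_vec_def)
  have "\<forall>i. \<exists>\<mu> :: 'l \<Rightarrow> real. (\<forall>j. \<mu> j \<ge> 0)
      \<and> (\<forall>y. \<kappa> i * (y $ fst_idx D)\<^sup>2 + (\<Sum>j\<in>UNIV. \<mu> j * (y \<bullet> (W_mat D j *v y)))
             \<le> y $ fst_idx D * (c_vec D \<sigma> i \<bullet> y))"
    by (rule allI, rule linear_lower_bound_multipliers[OF slater scalar]) blast+
  from choice[OF this] obtain \<mu> :: "'m \<Rightarrow> 'l \<Rightarrow> real" where \<mu>: "\<And>i j. \<mu> i j \<ge> 0"
    and bound: "\<And>i y. \<kappa> i * (y $ fst_idx D)\<^sup>2 + (\<Sum>j\<in>UNIV. \<mu> i j * (y \<bullet> (W_mat D j *v y)))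
             \<le> y $ fst_idx D * (c_vec D \<sigma> i \<bullet> y)"
    by blast
  define \<Lambda> :: "real^'l^'m" where "\<Lambda> = (\<chi> i j. - \<mu> i j)"
  have "nsd (majorizer (Ap (Some i)) (An (Some i)) ?V ?V - cmat (C_mat D \<sigma> i)
      + cmat ((b_vec D \<sigma> i \<bullet> ?x) *\<^sub>R ?E) - cmat (\<Sum>j\<in>UNIV. \<Lambda> $ i $ j *\<^sub>R W_mat D j))" for i
  proof -
    let ?A = "A_mat D \<sigma> (Some i)"
    define Q where "Q = \<kappa> i *\<^sub>R ?E - C_mat D \<sigma> i - (\<Sum>j\<in>UNIV. \<Lambda> $ i $ j *\<^sub>R W_mat D j)"
    have A: "?A = Ap (Some i) + An (Some i)" and "hermitian ?A"
      using parts[of i] by (auto simp: semidef_parts_def psd_def nsd_def intro: hermitian_add)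
    then have "majorizer (Ap (Some i)) (An (Some i)) ?V ?V
        = cscale (complex_of_real (Re (qform ?A v))) (outer (e1 D) (e1 D))"
      using qform_hermitian[of ?A v] by (simp add: majorizer_refl congruence_outer del: A_mat.simps)
    also have "\<dots> = cmat (Re (qform ?A v) *\<^sub>R ?E)"
      by (simp add: cscale_def outer_def vec_eq_iff e1_def axis_def)
    finally have "majorizer (Ap (Some i)) (An (Some i)) ?V ?V - cmat (C_mat D \<sigma> i)
      + cmat ((b_vec D \<sigma> i \<bullet> ?x) *\<^sub>R ?E) - cmat (\<Sum>j\<in>UNIV. \<Lambda> $ i $ j *\<^sub>R W_mat D j) = cmat Q"
      by (simp add: Q_def \<kappa>_def vec_eq_iff algebra_simps del: A_mat.simps)
    moreover have "nsd (cmat Q)"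
    proof (rule nsd_cmatI)
      show "transpose Q = Q"
        using transpose_C_mat[of D \<sigma> i] transpose_W_mat[of D] transpose_outer_self[of "e1 D"]
        by (simp add: Q_def transpose_def vec_eq_iff)
      fix y
      have "y \<bullet> (Q *v y) = \<kappa> i * (y $ fst_idx D)\<^sup>2 - y $ fst_idx D * (c_vec D \<sigma> i \<bullet> y)
          + (\<Sum>j\<in>UNIV. \<mu> i j * (y \<bullet> (W_mat D j *v y)))"
        unfolding Q_def C_mat_def
        by (simp add: matrix_vector_mult_diff_rdistrib matrix_vector_mult_add_rdistrib
            inner_diff_right inner_add_right inner_outer_mult inner_e1 inner_sum_scaleR_mult
            power2_eq_square \<Lambda>_def sum_negf flip: scaleR_matrix_vector_assoc)
      then show "y \<bullet> (Q *v y) \<le> 0"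
        using bound[of i y] by simp
    qed
    ultimately show ?thesis
      by simp
  qed
  moreover have "\<Lambda> \<le> 0"
    using \<mu> by (simp add: \<Lambda>_def less_eq_vec_def)
  ultimately have "(?x, ?V, \<Lambda>) \<in> F_set D \<sigma> Ap An ?V"
    unfolding F_set_def mem_Collect_eq prod.case
    using injection_dispatch_capacity[OF cap slater(1) v] by blast
  then show thesis
    by (rule that)
qed


section \<open>The recursion\<close>

text \<open>Replacing the reference point \<open>Z\<close> by \<open>V\<close> itself lowers every majorizer, so a solution remains
  feasible after the linearization is moved to it.\<close>

lemma F_set_self:
  fixes D :: "('n::finite, 'k::finite, 'l::finite) acopf" and \<sigma> :: "'m::finite \<Rightarrow> 'n con"
  assumes parts: "\<And>i. semidef_parts (A_mat D \<sigma> (Some i)) (Ap (Some i)) (An (Some i))"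
    and F: "(x, V, \<Lambda>) \<in> F_set D \<sigma> Ap An Z"
  shows "(x, V, \<Lambda>) \<in> F_set D \<sigma> Ap An V"
proof -
  have move: "nsd (majorizer (Ap (Some i)) (An (Some i)) V V + R)"
    if "nsd (majorizer (Ap (Some i)) (An (Some i)) V Z + R)" for i R
  proof -
    let ?H = "majorizer (Ap (Some i)) (An (Some i)) V"
    have nsd: "nsd (An (Some i))"
      using parts[of i] by (simp add: semidef_parts_def)
    have gap: "psd (?H Z - ?H V)"
      by (rule psd_majorization[OF nsd])
    have "hermitian (?H Z + R)" "hermitian (?H Z - ?H V)"
      using that gap by (auto simp: nsd_def psd_def)
    then have "hermitian ((?H Z + R) - (?H Z - ?H V))"
      by (rule hermitian_diff)
    then have "hermitian (?H V + R)"
      by (simp add: add.commute)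
    then show ?thesis
      using gap by (intro nsd_mono[OF that]) (simp_all add: psd_def qform_add qform_diff)
  qed
  have eq: "X - A + B - C = X + (B - A - C)" for X A B C :: "complex^'k^'k"
    by simp
  show ?thesis
    using F move unfolding F_set_def mem_Collect_eq prod.case eq by blast
qed

theorem proposition3:
  fixes D :: "('n::finite, 'k::finite, 'l::finite) acopf"
    and \<sigma> :: "'m::finite \<Rightarrow> 'n con"
    and P :: "'w measure"
    and \<xi> :: "'w \<Rightarrow> real^'k"
    and M :: "real^'k^'k"
    and Ap An :: "'m option \<Rightarrow> complex^'n^'n"
    and v0 :: "complex^'n"
    and T :: enat
    and x :: "nat \<Rightarrow> real^('n + 'n)"
    and V :: "nat \<Rightarrow> complex^'k^'n"
    and \<Lambda> :: "nat \<Rightarrow> real^'l^'m"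
  assumes "prob_space P"
    and "\<xi> \<in> borel_measurable P"
    and "rv_support P \<xi> = Xi D"
    and "Xi D \<noteq> {}"
    and "compact (Xi D)"
    and "\<exists>\<zeta>\<in>Xi D. \<forall>j. \<zeta> \<bullet> (W_mat D j *v \<zeta>) > 0"
    and "M = second_moment P \<xi>"
    and "\<forall>i j. (i, j) \<in> edges D \<longleftrightarrow> (j, i) \<in> edges D"
    and "\<forall>i. mcost D $ i \<ge> 0"
    and "\<forall>i. r_min D $ i \<le>\<^sub>c 0 \<and> 0 \<le>\<^sub>c r_max D $ i"
    and "\<forall>i. v_min D $ i \<ge> 0"
    and "\<forall>\<zeta>\<in>Xi D. \<forall>i. g_min D $ i \<le>\<^sub>c g_lo D \<zeta> $ i
           \<and> g_lo D \<zeta> $ i \<le>\<^sub>c g_up D \<zeta> $ i \<and> g_up D \<zeta> $ i \<le>\<^sub>c g_max D $ i"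
    and "bij_betw \<sigma> UNIV (con_set (edges D))"
    and "\<forall>i. semidef_parts (A_mat D \<sigma> i) (Ap i) (An i)"
    and "v0 \<in> zero_recourse_feasible D"
    and "V 0 = outer v0 (e1 D)"
    and "\<forall>t. enat t < T \<longrightarrow>
           is_arg_min (\<lambda>(x', V', \<Lambda>'). Re (trace (cmat M ** majorizer (Ap None) (An None) V' (V t))))
             (\<lambda>s. s \<in> F_set D \<sigma> Ap An (V t))
             (x (Suc t), V (Suc t), \<Lambda> (Suc t))"
  shows "(\<forall>t. enat t \<le> T \<longrightarrow> F_set D \<sigma> Ap An (V t) \<noteq> {})
       \<and> (\<forall>t\<ge>1. enat t \<le> T \<longrightarrow>
            Re (trace (cmat M ** (cadj (V t) ** A0_mat D ** V t)))
            \<le> Re (trace (cmat M ** (cadj (V (t - 1)) ** A0_mat D ** V (t - 1)))))"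
proof -
  note prob = assms(1)
  have parts: "semidef_parts (A_mat D \<sigma> i) (Ap i) (An i)" for i
    using assms(14) by blast
  have step: "is_arg_min (\<lambda>(x', V', \<Lambda>'). Re (trace (cmat M ** majorizer (Ap None) (An None) V' (V t))))
      (\<lambda>s. s \<in> F_set D \<sigma> Ap An (V t)) (x (Suc t), V (Suc t), \<Lambda> (Suc t))" if "enat t < T" for t
    using assms(17) that by blast
  have pred: "enat t < T" if "enat (Suc t) \<le> T" for t
    using that Suc_ile_eq by blast
  have self: "\<exists>x' \<Lambda>'. (x', V t, \<Lambda>') \<in> F_set D \<sigma> Ap An (V t)" if "enat t \<le> T" for t
  proof (cases t)
    case 0
    obtain \<zeta> where \<zeta>: "\<zeta> \<in> Xi D" "\<And>j. \<zeta> \<bullet> (W_mat D j *v \<zeta>) > 0"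
      using assms(6) by blast
    have \<sigma>: "range \<sigma> \<subseteq> con_set (edges D)"
      using assms(13) by (simp add: bij_betw_def)
    obtain \<Lambda>0 where "(injection_dispatch D v0, V 0, \<Lambda>0) \<in> F_set D \<sigma> Ap An (V 0)"
      unfolding assms(16)
      by (rule zero_recourse_in_F_set[OF \<zeta> assms(10-12) \<sigma> parts assms(15)])
    then show ?thesis
      using 0 by blast
  next
    case (Suc s)
    then have "(x t, V t, \<Lambda> t) \<in> F_set D \<sigma> Ap An (V s)"
      using step[OF pred] that by (simp add: is_arg_min_def)
    then show ?thesis
      using F_set_self[OF parts] by blast
  qed
  have mono: "Re (trace (cmat M ** (cadj (V (Suc s)) ** A0_mat D ** V (Suc s))))
      \<le> Re (trace (cmat M ** (cadj (V s) ** A0_mat D ** V s)))" if le: "enat (Suc s) \<le> T" for s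
  proof -
    let ?H = "majorizer (Ap None) (An None)"
    have touch: "?H U U = cadj U ** A0_mat D ** U" for U :: "complex^'k^'n"
      using parts[of None] by (simp add: majorizer_refl semidef_parts_def)
    have "psd (?H (V (Suc s)) (V s) - ?H (V (Suc s)) (V (Suc s)))"
      using parts[of None] by (intro psd_majorization) (simp add: semidef_parts_def)
    then have "0 \<le> Re (trace (cmat M ** (?H (V (Suc s)) (V s) - ?H (V (Suc s)) (V (Suc s)))))"
      unfolding assms(7)
      by (intro prob_space.trace_second_moment_nonneg[OF prob assms(2)])
        (simp_all add: assms(3,5) compact_imp_bounded)
    then have "Re (trace (cmat M ** ?H (V (Suc s)) (V (Suc s))))
        \<le> Re (trace (cmat M ** ?H (V (Suc s)) (V s)))"
      by (simp add: matrix_mult_diff_right trace_sub)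
    also have "\<dots> \<le> Re (trace (cmat M ** ?H (V s) (V s)))"
    proof -
      obtain x' \<Lambda>' where "(x', V s, \<Lambda>') \<in> F_set D \<sigma> Ap An (V s)"
        using self[of s] pred[OF le] by (auto simp: less_imp_le)
      then show ?thesis
        using step[OF pred[OF le]] by (force simp: is_arg_min_def not_less)
    qed
    finally show ?thesis
      by (simp only: touch)
  qed
  have "Re (trace (cmat M ** (cadj (V t) ** A0_mat D ** V t)))
      \<le> Re (trace (cmat M ** (cadj (V (t - 1)) ** A0_mat D ** V (t - 1))))"
    if "1 \<le> t" "enat t \<le> T" for t
    using mono[of "t - 1"] that by simp
  then show ?thesis
    using self by blast
qed

end
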